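(* Let $(X,d)$ be a finite semi-pseudometric space and suppose that $q>0$ is a positive real number. Let $U_{\leq q}=\{(x,y)\in X\times X\mid d(x,y)\leq q\}$. Then $$H^{VR}_*(X,\mathcal{F}_q)\cong H_*\left(\Sigma^X_{U_{\leq q}}\right)\quad\text{and}\quad H_{VR}^*(X,\mathcal{F}_q)\cong H^*\left(\Sigma^X_{U_{\leq q}}\right).$$
   Context: A semi-pseudometric on a set $X$ is a map $d\colon X\times X\to\mathbb{R}$ with $d(x,x)=0$ and $d(x,y)=d(y,x)$ for all $x,y\in X$. For $q\geq 0$ let $d_q(x,y)=d(x,y)-q$ if $d(x,y)>q$ and $d_q(x,y)=0$ if $d(x,y)\leq q$. The semi-uniformity $\mathcal{F}_q$ induced by $d$ at scale $q$ is the filter on $X\times X$ generated by the sets $\{(x,y)\mid d_q(x,y)<r\}$, $r>0$. For a relation $U\subset X\times X$, the Vietoris-Rips complex $\Sigma^X_U$ is the simplicial complex with vertex set $X$ in which a finite nonempty set is a simplex iff its elements can be ordered as $x_0,\dots,x_k$ (distinct) so that $(x_i,x_j)\in U$ for all $i<j$. (If $U$ is symmetric this is the clique complex of the graph with edge relation $U$.) For a semi-uniform structure $\mathcal{F}$ on $X$ (a filter on $X\times X$ each of whose elements contains the diagonal and such that $U\in\mathcal{F}$ implies $U^{-1}=\{(y,x)\mid (x,y)\in U\}\in\mathcal{F}$; for example $\mathcal{F}=\mathcal{F}_q$), with integer coefficients, $H_*^{VR}(X,\mathcal{F})=\varprojlim_{U\in\mathcal{F}}H_*(\Sigma^X_U)$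 and $H^*_{VR}(X,\mathcal{F})=\varinjlim_{U\in\mathcal{F}}H^*(\Sigma^X_U)$, with structure maps induced by the inclusions $\Sigma^X_U\subset\Sigma^X_{U'}$ for $U\subset U'$ in $\mathcal{F}$. *)

theory Defs
  imports Complex_Main "HOL-Algebra.Product_Groups" "HOL-Algebra.Elementary_Groups"
begin

section \<open>Simplicial homology and cohomology with integer coefficients\<close>

definition simplicial_complex :: "'a set set \<Rightarrow> bool" where
  "simplicial_complex K \<longleftrightarrow>
     (\<forall>s\<in>K. finite s \<and> s \<noteq> {} \<and> (\<forall>t. t \<subseteq> s \<and> t \<noteq> {} \<longrightarrow> t \<in> K))"

text \<open>An ordered n-simplex of a complex is a list of n + 1 distinct vertices spanning a
  simplex.\<close>

definition ordered_simplices :: "'a set set \<Rightarrow> nat \<Rightarrow> 'a list set" where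
  "ordered_simplices K n = {xs. distinct xs \<and> length xs = Suc n \<and> set xs \<in> K}"

text \<open>An (oriented) n-chain is an integer-valued function on the oriented n-simplices that
  has finite support and changes sign when the orientation is reversed. It is represented as
  a function of the orderings of the vertices. Two orderings give the same orientation iff
  they differ by an even permutation, so the sign rule amounts to a change of sign under
  transposition of adjacent vertices. For a subcomplex, the inclusion of chain
  groups (extension by zero) is the identity on these functions.\<close>

definition chain_group :: "'a set set \<Rightarrow> nat \<Rightarrow> ('a list \<Rightarrow> int) monoid" where
  "chain_group K n =
     \<lparr>carrier = {c. finite {xs. c xs \<noteq> 0} \<and> {xs. c xs \<noteq> 0} \<subseteq> ordered_simplices K n \<and>
                    (\<forall>us a b vs. c (us @ a # b # vs) = - c (us @ b # a # vs))},
      monoid.mult = (\<lambda>c c' xs. c xs + c' xs),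
      one = (\<lambda>xs. 0)\<rparr>"

text \<open>On the elementary chain of an oriented simplex the boundary is the alternating sum of
  the oriented faces (see \<open>boundary_elementary\<close> below). The coefficient of an oriented
  simplex y in the boundary of c is thus the sum of the coefficients in c of all oriented
  simplices (v, y), of which y is the face with sign +1. The boundary of a 0-chain is
  zero.\<close>

definition boundary :: "('a list \<Rightarrow> int) \<Rightarrow> 'a list \<Rightarrow> int" where
  "boundary c = (\<lambda>ys. if ys = [] then 0 else (\<Sum>v | c (v # ys) \<noteq> 0. c (v # ys)))"

definition cycles :: "'a set set \<Rightarrow> nat \<Rightarrow> ('a list \<Rightarrow> int) set" where
  "cycles K n = {c \<in> carrier (chain_group K n). boundary c = (\<lambda>ys. 0)}"

definition boundaries :: "'a set set \<Rightarrow> nat \<Rightarrow> ('a list \<Rightarrow> int) set" where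
  "boundaries K n = boundary ` carrier (chain_group K (Suc n))"

definition simplicial_homology :: "'a set set \<Rightarrow> nat \<Rightarrow> ('a list \<Rightarrow> int) set monoid" where
  "simplicial_homology K n = (chain_group K n)\<lparr>carrier := cycles K n\<rparr> Mod boundaries K n"

text \<open>The map in homology induced by the inclusion of a complex into a complex L: the class of
  a cycle z, a coset of the smaller group of boundaries, is sent to the coset of z modulo the
  boundaries of L.\<close>

definition homology_inclusion ::
    "'a set set \<Rightarrow> nat \<Rightarrow> ('a list \<Rightarrow> int) set \<Rightarrow> ('a list \<Rightarrow> int) set" where
  "homology_inclusion L n A = boundaries L n <#>\<^bsub>chain_group L n\<^esub> A"

definition cochain_group :: "'a set set \<Rightarrow> nat \<Rightarrow> (('a list \<Rightarrow> int) \<Rightarrow> int) monoid" where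
  "cochain_group K n =
     \<lparr>carrier = hom (chain_group K n) integer_group \<inter> extensional (carrier (chain_group K n)),
      monoid.mult = (\<lambda>\<phi> \<psi>. \<lambda>c\<in>carrier (chain_group K n). \<phi> c + \<psi> c),
      one = (\<lambda>c\<in>carrier (chain_group K n). 0)\<rparr>"

definition coboundary ::
    "'a set set \<Rightarrow> nat \<Rightarrow> (('a list \<Rightarrow> int) \<Rightarrow> int) \<Rightarrow> (('a list \<Rightarrow> int) \<Rightarrow> int)" where
  "coboundary K n \<phi> = (\<lambda>c\<in>carrier (chain_group K (Suc n)). \<phi> (boundary c))"

definition cocycles :: "'a set set \<Rightarrow> nat \<Rightarrow> (('a list \<Rightarrow> int) \<Rightarrow> int) set" where
  "cocycles K n =
     {\<phi> \<in> carrier (cochain_group K n). coboundary K n \<phi> = \<one>\<^bsub>cochain_group K (Suc n)\<^esub>}"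

definition coboundaries :: "'a set set \<Rightarrow> nat \<Rightarrow> (('a list \<Rightarrow> int) \<Rightarrow> int) set" where
  "coboundaries K n =
     (case n of 0 \<Rightarrow> {\<one>\<^bsub>cochain_group K 0\<^esub>}
      | Suc m \<Rightarrow> coboundary K m ` carrier (cochain_group K m))"

definition simplicial_cohomology ::
    "'a set set \<Rightarrow> nat \<Rightarrow> (('a list \<Rightarrow> int) \<Rightarrow> int) set monoid" where
  "simplicial_cohomology K n =
     (cochain_group K n)\<lparr>carrier := cocycles K n\<rparr> Mod coboundaries K n"

text \<open>The map in cohomology induced by the inclusion of a complex K into a larger one:
  restriction of cochains to the chains of K.\<close>

definition cohomology_inclusion ::
    "'a set set \<Rightarrow> nat \<Rightarrow> (('a list \<Rightarrow> int) \<Rightarrow> int) set \<Rightarrow> (('a list \<Rightarrow> int) \<Rightarrow> int) set" where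
  "cohomology_inclusion K n A =
     coboundaries K n <#>\<^bsub>cochain_group K n\<^esub> ((\<lambda>\<phi>. restrict \<phi> (carrier (chain_group K n))) ` A)"

section \<open>Limits and colimits of systems of abelian groups\<close>

text \<open>A system over an index set I, preordered by \<open>R\<close>, has maps \<open>f i j\<close> from \<open>G i\<close> to
  \<open>G j\<close> whenever \<open>R i j\<close>.\<close>

definition limit_group ::
    "'i set \<Rightarrow> ('i \<Rightarrow> 'i \<Rightarrow> bool) \<Rightarrow> ('i \<Rightarrow> 'g monoid) \<Rightarrow> ('i \<Rightarrow> 'i \<Rightarrow> 'g \<Rightarrow> 'g) \<Rightarrow> ('i \<Rightarrow> 'g) monoid"
  where
  "limit_group I R G f =
     (product_group I G)
       \<lparr>carrier := {x \<in> carrier (product_group I G).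
                     \<forall>i\<in>I. \<forall>j\<in>I. R i j \<longrightarrow> f i j (x i) = x j}\<rparr>"

definition summand_inclusion :: "'i set \<Rightarrow> ('i \<Rightarrow> 'g monoid) \<Rightarrow> 'i \<Rightarrow> 'g \<Rightarrow> 'i \<Rightarrow> 'g" where
  "summand_inclusion I G i a = (\<lambda>k\<in>I. if k = i then a else \<one>\<^bsub>G k\<^esub>)"

text \<open>The colimit is the direct sum modulo the identification of each element with its
  images under the structure maps.\<close>

definition colimit_group ::
    "'i set \<Rightarrow> ('i \<Rightarrow> 'i \<Rightarrow> bool) \<Rightarrow> ('i \<Rightarrow> 'g monoid) \<Rightarrow> ('i \<Rightarrow> 'i \<Rightarrow> 'g \<Rightarrow> 'g) \<Rightarrow> ('i \<Rightarrow> 'g) set monoid"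
  where
  "colimit_group I R G f =
     sum_group I G Mod
       generate (sum_group I G)
         {summand_inclusion I G i a \<otimes>\<^bsub>sum_group I G\<^esub>
            inv\<^bsub>sum_group I G\<^esub> (summand_inclusion I G j (f i j a)) | i j a.
            i \<in> I \<and> j \<in> I \<and> R i j \<and> a \<in> carrier (G i)}"

section \<open>Semi-uniform structures and Vietoris-Rips (co)homology\<close>

text \<open>A filter on \<open>X \<times> X\<close> is represented by a filter on pairs that contains \<open>X \<times> X\<close>; its
  members as a filter on \<open>X \<times> X\<close> are the following sets.\<close>

definition entourages :: "'a set \<Rightarrow> ('a \<times> 'a) filter \<Rightarrow> ('a \<times> 'a) set set" where
  "entourages X F = {U. U \<subseteq> X \<times> X \<and> eventually (\<lambda>p. p \<in> U) F}"

definition semi_uniform_structure :: "'a set \<Rightarrow> ('a \<times> 'a) filter \<Rightarrow> bool" where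
  "semi_uniform_structure X F \<longleftrightarrow>
     F \<le> principal (X \<times> X) \<and> (\<forall>U\<in>entourages X F. Id_on X \<subseteq> U \<and> U\<inverse> \<in> entourages X F)"

definition vr_complex :: "'a set \<Rightarrow> ('a \<times> 'a) set \<Rightarrow> 'a set set" where
  "vr_complex X U =
     {set xs | xs. xs \<noteq> [] \<and> distinct xs \<and> set xs \<subseteq> X \<and> sorted_wrt (\<lambda>x y. (x, y) \<in> U) xs}"

definition vr_homology ::
    "'a set \<Rightarrow> ('a \<times> 'a) filter \<Rightarrow> nat \<Rightarrow> (('a \<times> 'a) set \<Rightarrow> ('a list \<Rightarrow> int) set) monoid" where
  "vr_homology X F n =
     limit_group (entourages X F) (\<lambda>U V. U \<subseteq> V)
       (\<lambda>U. simplicial_homology (vr_complex X U) n)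
       (\<lambda>U V. homology_inclusion (vr_complex X V) n)"

definition vr_cohomology ::
    "'a set \<Rightarrow> ('a \<times> 'a) filter \<Rightarrow> nat \<Rightarrow>
      (('a \<times> 'a) set \<Rightarrow> (('a list \<Rightarrow> int) \<Rightarrow> int) set) set monoid" where
  "vr_cohomology X F n =
     colimit_group (entourages X F) (\<lambda>U V. V \<subseteq> U)
       (\<lambda>U. simplicial_cohomology (vr_complex X U) n)
       (\<lambda>U V. cohomology_inclusion (vr_complex X V) n)"

text \<open>Distances may be negative, and the triangle inequality is not required.\<close>

definition semi_pseudometric :: "'a set \<Rightarrow> ('a \<Rightarrow> 'a \<Rightarrow> real) \<Rightarrow> bool" where
  "semi_pseudometric X d \<longleftrightarrow> (\<forall>x\<in>X. d x x = 0) \<and> (\<forall>x\<in>X. \<forall>y\<in>X. d x y = d y x)"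

definition scaled_dist :: "('a \<Rightarrow> 'a \<Rightarrow> real) \<Rightarrow> real \<Rightarrow> 'a \<Rightarrow> 'a \<Rightarrow> real" where
  "scaled_dist d q x y = (if d x y > q then d x y - q else 0)"

definition semi_uniformity_at :: "'a set \<Rightarrow> ('a \<Rightarrow> 'a \<Rightarrow> real) \<Rightarrow> real \<Rightarrow> ('a \<times> 'a) filter" where
  "semi_uniformity_at X d q =
     (INF r\<in>{0<..}. principal {(x, y). x \<in> X \<and> y \<in> X \<and> scaled_dist d q x y < r})"

section \<open>Basic properties\<close>

lemma chain_alternating:
  assumes "c \<in> carrier (chain_group K n)"
  shows "c (us @ a # b # vs) = - c (us @ b # a # vs)"
  using assms unfolding chain_group_def partial_object.simps by blast

lemma chain_group_simps [simp]:
  "monoid.mult (chain_group K n) = (\<lambda>c c' xs. c xs + c' xs)"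
  "one (chain_group K n) = (\<lambda>xs. 0)"
  by (simp_all add: chain_group_def)

lemma chainD:
  assumes "c \<in> carrier (chain_group K n)"
  shows "finite {xs. c xs \<noteq> 0}" "c xs \<noteq> 0 \<Longrightarrow> xs \<in> ordered_simplices K n"
  using assms unfolding chain_group_def partial_object.simps by blast+

lemma chainI:
  assumes "finite {xs. c xs \<noteq> 0}" "\<And>xs. c xs \<noteq> 0 \<Longrightarrow> xs \<in> ordered_simplices K n"
    and "\<And>us a b vs. c (us @ a # b # vs) = - c (us @ b # a # vs)"
  shows "c \<in> carrier (chain_group K n)"
  unfolding chain_group_def partial_object.simps using assms by blast

lemma chain_move_front:
  assumes "c \<in> carrier (chain_group K n)"
  shows "c (v # us @ vs) = (-1) ^ length us * c (us @ v # vs)"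
proof (induction us arbitrary: vs rule: rev_induct)
  case (snoc u us)
  have "c (v # (us @ [u]) @ vs) = (-1) ^ length us * c (us @ v # u # vs)"
    using snoc [of "u # vs"] by simp
  also have "c (us @ v # u # vs) = - c (us @ u # v # vs)"
    by (rule chain_alternating [OF assms])
  finally have "c (v # (us @ [u]) @ vs) = (-1) ^ length us * - c (us @ u # v # vs)" .
  then show ?case by simp
qed simp

lemma boundary_nonzero: "boundary c ys \<noteq> 0 \<Longrightarrow> \<exists>v. c (v # ys) \<noteq> 0"
  unfolding boundary_def by (metis (mono_tags, lifting) sum.neutral)

text \<open>If c is the elementary chain of the oriented simplex xs, that is, c takes the value 1
  on xs and vanishes off the reorderings of xs, then its boundary takes the value
  \<open>(-1) ^ i\<close> on the i-th face of xs and vanishes off the reorderings of the faces.\<close>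

lemma boundary_elementary:
  assumes c: "c \<in> carrier (chain_group K (Suc n))" and xs: "distinct xs" "length xs = Suc (Suc n)"
    and "c xs = 1" and supp: "\<And>ys. c ys \<noteq> 0 \<Longrightarrow> set ys = set xs"
  shows "i < length xs \<Longrightarrow> boundary c (take i xs @ drop (Suc i) xs) = (-1) ^ i"
    and "boundary c ys \<noteq> 0 \<Longrightarrow> distinct ys \<and> (\<exists>i<length xs. set ys = set xs - {xs ! i})"
proof -
  have dist: "distinct zs" if "c zs \<noteq> 0" for zs
    using chainD(2) [OF c that] by (simp add: ordered_simplices_def)
  {
    assume i: "i < length xs"
    let ?f = "take i xs @ drop (Suc i) xs"
    have split: "take i xs @ xs ! i # drop (Suc i) xs = xs"
      using i by (simp add: id_take_nth_drop [symmetric])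
    have val: "c (xs ! i # ?f) = (-1) ^ i"
      using chain_move_front [OF c, of "xs ! i" "take i xs" "drop (Suc i) xs"] split i assms(4)
      by simp
    have "v = xs ! i" if "c (v # ?f) \<noteq> 0" for v
    proof -
      have "set (v # ?f) = set xs" "distinct (v # ?f)"
        using supp dist that by blast+
      moreover have "set xs = insert (xs ! i) (set ?f)"
        by (subst split [symmetric]) auto
      ultimately show ?thesis by auto
    qed
    then have S: "{v. c (v # ?f) \<noteq> 0} = {xs ! i}"
      using val by auto
    have "length ?f = Suc n"
      using i xs by simp
    then have "?f \<noteq> []"
      by (metis length_0_conv nat.distinct(1))
    then show "boundary c ?f = (-1) ^ i"
      unfolding boundary_def S using val by simp
  }
  assume "boundary c ys \<noteq> 0"
  then obtain v where v: "c (v # ys) \<noteq> 0"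
    using boundary_nonzero by blast
  then have *: "set (v # ys) = set xs" "distinct (v # ys)"
    using supp dist by blast+
  then obtain i where "i < length xs" "xs ! i = v"
    by (metis in_set_conv_nth list.set_intros(1))
  with * show "distinct ys \<and> (\<exists>i<length xs. set ys = set xs - {xs ! i})"
    by (intro conjI exI [of _ i]) auto
qed

lemma chain_add_closed:
  assumes c: "c \<in> carrier (chain_group K n)" and c': "c' \<in> carrier (chain_group K n)"
  shows "(\<lambda>xs. c xs + c' xs) \<in> carrier (chain_group K n)"
proof (rule chainI)
  have "{xs. c xs + c' xs \<noteq> 0} \<subseteq> {xs. c xs \<noteq> 0} \<union> {xs. c' xs \<noteq> 0}"
    by auto
  then show "finite {xs. c xs + c' xs \<noteq> 0}"
    by (rule finite_subset) (simp add: chainD(1) [OF c] chainD(1) [OF c'])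
  show "xs \<in> ordered_simplices K n" if "c xs + c' xs \<noteq> 0" for xs
    using that chainD(2) [OF c, of xs] chainD(2) [OF c', of xs] by (cases "c xs = 0") auto
  show "c (us @ a # b # vs) + c' (us @ a # b # vs) = - (c (us @ b # a # vs) + c' (us @ b # a # vs))"
    for us a b vs
    using chain_alternating [OF c, of us a b vs] chain_alternating [OF c', of us a b vs] by linarith
qed

lemma comm_group_chain_group: "comm_group (chain_group K n)"
proof (rule comm_groupI)
  fix c assume c: "c \<in> carrier (chain_group K n)"
  have "(\<lambda>xs. - c xs) \<in> carrier (chain_group K n)"
  proof (rule chainI)
    show "- c (us @ a # b # vs) = - (- c (us @ b # a # vs))" for us a b vs
      using chain_alternating [OF c, of us a b vs] by linarith
  qed (use chainD [OF c] in auto)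
  then show "\<exists>c'\<in>carrier (chain_group K n). c' \<otimes>\<^bsub>chain_group K n\<^esub> c = \<one>\<^bsub>chain_group K n\<^esub>"
    by (rule bexI [rotated]) simp
next
  show "\<one>\<^bsub>chain_group K n\<^esub> \<in> carrier (chain_group K n)"
    by (rule chainI) auto
qed (auto simp: chain_add_closed algebra_simps)

lemma boundary_eq_sum:
  assumes "finite V" "\<And>v. c (v # ys) \<noteq> 0 \<Longrightarrow> v \<in> V"
  shows "boundary c ys = (if ys = [] then 0 else (\<Sum>v\<in>V. c (v # ys)))"
  unfolding boundary_def using assms by (auto intro!: sum.mono_neutral_left)

lemma chain_vertices:
  assumes "c \<in> carrier (chain_group K n)"
  shows "finite (\<Union>xs\<in>{xs. c xs \<noteq> 0}. set xs)"
  using chainD(1) [OF assms] by simp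

lemma boundary_closed:
  assumes K: "simplicial_complex K" and c: "c \<in> carrier (chain_group K (Suc n))"
  shows "boundary c \<in> carrier (chain_group K n)"
proof -
  have "{ys. boundary c ys \<noteq> 0} \<subseteq> tl ` {xs. c xs \<noteq> 0}"
    using boundary_nonzero by force
  moreover have "finite {xs. c xs \<noteq> 0}"
    by (rule chainD(1) [OF c])
  ultimately have 1: "finite {ys. boundary c ys \<noteq> 0}"
    using finite_surj by blast
  have 2: "ys \<in> ordered_simplices K n" if b: "boundary c ys \<noteq> 0" for ys
  proof -
    obtain v where "c (v # ys) \<noteq> 0"
      using boundary_nonzero [OF b] by blast
    then have v: "distinct (v # ys)" "length (v # ys) = Suc (Suc n)" "set (v # ys) \<in> K"
      using chainD(2) [OF c] by (force simp: ordered_simplices_def)+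
    have "ys \<noteq> []"
      using v by auto
    then have "set ys \<in> K"
      using K v unfolding simplicial_complex_def by (metis set_empty set_subset_Cons)
    with v show ?thesis
      by (simp add: ordered_simplices_def)
  qed
  have 3: "boundary c (us @ a # b # vs) = - boundary c (us @ b # a # vs)" for us a b vs
  proof -
    have "c (v # us @ a # b # vs) = - c (v # us @ b # a # vs)" for v
      using chain_alternating [OF c, of "v # us" a b vs] by simp
    then show ?thesis
      by (simp add: boundary_def sum_negf)
  qed
  from 1 2 3 show ?thesis
    by (rule chainI)
qed

lemma boundary_add:
  assumes "c \<in> carrier (chain_group K n)" "c' \<in> carrier (chain_group K n)"
  shows "boundary (\<lambda>xs. c xs + c' xs) = (\<lambda>ys. boundary c ys + boundary c' ys)"
proof
  fix ys
  define V where "V = (\<Union>xs\<in>{xs. c xs \<noteq> 0}. set xs) \<union> (\<Union>xs\<in>{xs. c' xs \<noteq> 0}. set xs)"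
  have V: "finite V"
    unfolding V_def using assms chain_vertices by blast
  have mem: "v \<in> V" if "c (v # ys) \<noteq> 0 \<or> c' (v # ys) \<noteq> 0" for v
    unfolding V_def using that by (metis (mono_tags, lifting) UN_I UnCI list.set_intros(1) mem_Collect_eq)
  have "boundary (\<lambda>xs. c xs + c' xs) ys =
      (if ys = [] then 0 else (\<Sum>v\<in>V. c (v # ys) + c' (v # ys)))"
    by (rule boundary_eq_sum [OF V]) (metis add.right_neutral mem)
  moreover have "boundary c ys = (if ys = [] then 0 else (\<Sum>v\<in>V. c (v # ys)))"
    by (rule boundary_eq_sum [OF V]) (use mem in blast)
  moreover have "boundary c' ys = (if ys = [] then 0 else (\<Sum>v\<in>V. c' (v # ys)))"
    by (rule boundary_eq_sum [OF V]) (use mem in blast)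
  ultimately show "boundary (\<lambda>xs. c xs + c' xs) ys = boundary c ys + boundary c' ys"
    by (simp add: sum.distrib)
qed

lemma boundary_hom:
  "simplicial_complex K \<Longrightarrow> boundary \<in> hom (chain_group K (Suc n)) (chain_group K n)"
  by (rule homI) (simp_all add: boundary_closed boundary_add)

lemma boundary_boundary:
  assumes c: "c \<in> carrier (chain_group K n)"
  shows "boundary (boundary c) = (\<lambda>ys. 0)"
proof
  fix ys
  define V where "V = (\<Union>xs\<in>{xs. c xs \<noteq> 0}. set xs)"
  have V: "finite V"
    unfolding V_def using c by (rule chain_vertices)
  have mem: "v \<in> V" if "c xs \<noteq> 0" "v \<in> set xs" for v xs
    unfolding V_def using that by blast
  have b: "boundary c zs = (if zs = [] then 0 else (\<Sum>v\<in>V. c (v # zs)))" for zs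
    by (rule boundary_eq_sum [OF V]) (rule mem, auto)
  have bmem: "w \<in> V" if w: "boundary c (w # ys) \<noteq> 0" for w
  proof -
    obtain v where "c (v # w # ys) \<noteq> 0"
      using boundary_nonzero [OF w] by blast
    then show ?thesis by (rule mem) simp
  qed
  have "boundary (boundary c) ys = (if ys = [] then 0 else (\<Sum>w\<in>V. boundary c (w # ys)))"
    by (rule boundary_eq_sum [OF V bmem])
  also have "\<dots> = (if ys = [] then 0 else (\<Sum>w\<in>V. \<Sum>v\<in>V. c (v # w # ys)))"
    by (simp add: b)
  also have "(\<Sum>w\<in>V. \<Sum>v\<in>V. c (v # w # ys)) = 0"
  proof -
    have "c (v # w # ys) = - c (w # v # ys)" for v w
      using chain_alternating [OF c, of "[]" v w ys] unfolding append_Nil .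
    then have "(\<Sum>w\<in>V. \<Sum>v\<in>V. c (v # w # ys)) = (\<Sum>w\<in>V. \<Sum>v\<in>V. - c (w # v # ys))"
      by (intro sum.cong refl)
    also have "\<dots> = (\<Sum>v\<in>V. \<Sum>w\<in>V. - c (w # v # ys))"
      by (rule sum.swap)
    also have "\<dots> = - (\<Sum>w\<in>V. \<Sum>v\<in>V. c (v # w # ys))"
      by (simp only: sum_negf)
    finally show ?thesis by linarith
  qed
  finally show "boundary (boundary c) ys = 0" by simp
qed

lemma comm_group_subquotient:
  assumes G: "comm_group G" and Z: "subgroup Z G" and B: "subgroup B G" and BZ: "B \<subseteq> Z"
  shows "comm_group (G\<lparr>carrier := Z\<rparr> Mod B)"
proof -
  interpret G: comm_group G by (rule G)
  have "comm_group (G\<lparr>carrier := Z\<rparr>)"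
  proof (rule group.group_comm_groupI)
    show "Group.group (G\<lparr>carrier := Z\<rparr>)"
      using Z by (rule subgroup.subgroup_is_group) (rule G.group_axioms)
    show "x \<otimes>\<^bsub>G\<lparr>carrier := Z\<rparr>\<^esub> y = y \<otimes>\<^bsub>G\<lparr>carrier := Z\<rparr>\<^esub> x"
      if "x \<in> carrier (G\<lparr>carrier := Z\<rparr>)" "y \<in> carrier (G\<lparr>carrier := Z\<rparr>)" for x y
      using that subgroup.subset [OF Z] by (auto intro: G.m_comm)
  qed
  moreover have "subgroup B (G\<lparr>carrier := Z\<rparr>)"
    by (rule G.subgroup_incl [OF B Z BZ])
  ultimately show ?thesis
    by (rule comm_group.abelian_FactGroup)
qed

lemma subquotient_map:
  assumes G: "comm_group G" "subgroup Z G" "subgroup B G" "B \<subseteq> Z"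
    and G': "comm_group G'" "subgroup Z' G'" "subgroup B' G'" "B' \<subseteq> Z'"
    and h: "h \<in> hom G G'" and hZ: "h ` Z \<subseteq> Z'" and hB: "h ` B \<subseteq> B'"
  shows "(\<lambda>A. B' <#>\<^bsub>G'\<^esub> h ` A) \<in> hom (G\<lparr>carrier := Z\<rparr> Mod B) (G'\<lparr>carrier := Z'\<rparr> Mod B')"
    and "z \<in> Z \<Longrightarrow> B' <#>\<^bsub>G'\<^esub> h ` (B #>\<^bsub>G\<^esub> z) = B' #>\<^bsub>G'\<^esub> h z"
proof -
  interpret G: comm_group G by (rule G)
  interpret G': comm_group G' by (rule G')
  have ZG: "Z \<subseteq> carrier G" and ZG': "Z' \<subseteq> carrier G'"
    using G(2) G'(2) subgroup.subset by blast+
  have BG': "B' \<subseteq> carrier G'"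
    using G'(3) subgroup.subset by blast
  have *: "B' <#>\<^bsub>G'\<^esub> h ` (B #>\<^bsub>G\<^esub> z) = B' #>\<^bsub>G'\<^esub> h z" if z: "z \<in> Z" for z
  proof (intro equalityI subsetI)
    fix x assume "x \<in> B' <#>\<^bsub>G'\<^esub> h ` (B #>\<^bsub>G\<^esub> z)"
    then obtain b' b where b: "b' \<in> B'" "b \<in> B" and x: "x = b' \<otimes>\<^bsub>G'\<^esub> h (b \<otimes>\<^bsub>G\<^esub> z)"
      by (auto simp: set_mult_def r_coset_def)
    have "h (b \<otimes>\<^bsub>G\<^esub> z) = h b \<otimes>\<^bsub>G'\<^esub> h z"
      by (rule hom_mult [OF h]) (use b z ZG G(4) in blast)+
    moreover have "b' \<in> carrier G'" "h b \<in> carrier G'" "h z \<in> carrier G'"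
      using b z hB hZ BG' ZG' by blast+
    ultimately have "x = (b' \<otimes>\<^bsub>G'\<^esub> h b) \<otimes>\<^bsub>G'\<^esub> h z"
      using x by (simp add: G'.m_assoc)
    moreover have "b' \<otimes>\<^bsub>G'\<^esub> h b \<in> B'"
      using b hB by (intro subgroup.m_closed [OF G'(3)]) auto
    ultimately show "x \<in> B' #>\<^bsub>G'\<^esub> h z"
      by (auto simp: r_coset_def)
  next
    fix x assume "x \<in> B' #>\<^bsub>G'\<^esub> h z"
    then obtain b' where "b' \<in> B'" and x: "x = b' \<otimes>\<^bsub>G'\<^esub> h z"
      by (auto simp: r_coset_def)
    moreover have "z \<in> B #>\<^bsub>G\<^esub> z"
      using z ZG by (intro G.rcos_self [OF _ G(3)]) auto
    ultimately show "x \<in> B' <#>\<^bsub>G'\<^esub> h ` (B #>\<^bsub>G\<^esub> z)"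
      by (auto simp: set_mult_def)
  qed
  then show "z \<in> Z \<Longrightarrow> B' <#>\<^bsub>G'\<^esub> h ` (B #>\<^bsub>G\<^esub> z) = B' #>\<^bsub>G'\<^esub> h z" .
  have N: "B \<lhd> G" and N': "B' \<lhd> G'"
    using G G' by (simp_all add: G.normal_iff_subgroup G'.normal_iff_subgroup)
  have car: "carrier (G\<lparr>carrier := Z\<rparr> Mod B) = (\<lambda>z. B #>\<^bsub>G\<^esub> z) ` Z"
    "carrier (G'\<lparr>carrier := Z'\<rparr> Mod B') = (\<lambda>z. B' #>\<^bsub>G'\<^esub> z) ` Z'"
    by (simp_all add: carrier_FactGroup r_coset_def)
  show "(\<lambda>A. B' <#>\<^bsub>G'\<^esub> h ` A) \<in> hom (G\<lparr>carrier := Z\<rparr> Mod B) (G'\<lparr>carrier := Z'\<rparr> Mod B')"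
  proof (rule homI)
    fix A assume "A \<in> carrier (G\<lparr>carrier := Z\<rparr> Mod B)"
    then show "B' <#>\<^bsub>G'\<^esub> h ` A \<in> carrier (G'\<lparr>carrier := Z'\<rparr> Mod B')"
      using * hZ unfolding car by auto
  next
    fix A1 A2
    assume "A1 \<in> carrier (G\<lparr>carrier := Z\<rparr> Mod B)" "A2 \<in> carrier (G\<lparr>carrier := Z\<rparr> Mod B)"
    then obtain z w where z: "z \<in> Z" "A1 = B #>\<^bsub>G\<^esub> z" and w: "w \<in> Z" "A2 = B #>\<^bsub>G\<^esub> w"
      unfolding car by blast
    have car_zw: "z \<in> carrier G" "w \<in> carrier G" "h z \<in> carrier G'" "h w \<in> carrier G'"
      using z w ZG ZG' hZ by blast+
    have zw: "z \<otimes>\<^bsub>G\<^esub> w \<in> Z"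
      using z w by (intro subgroup.m_closed [OF G(2)])
    have "A1 <#>\<^bsub>G\<^esub> A2 = B #>\<^bsub>G\<^esub> (z \<otimes>\<^bsub>G\<^esub> w)"
      unfolding z w by (rule normal.rcos_sum [OF N car_zw(1,2)])
    then have "B' <#>\<^bsub>G'\<^esub> h ` (A1 <#>\<^bsub>G\<^esub> A2) = B' #>\<^bsub>G'\<^esub> (h z \<otimes>\<^bsub>G'\<^esub> h w)"
      using * [OF zw] hom_mult [OF h car_zw(1,2)] by simp
    also have "\<dots> = (B' #>\<^bsub>G'\<^esub> h z) <#>\<^bsub>G'\<^esub> (B' #>\<^bsub>G'\<^esub> h w)"
      by (rule normal.rcos_sum [OF N' car_zw(3,4), symmetric])
    finally show "B' <#>\<^bsub>G'\<^esub> h ` (A1 \<otimes>\<^bsub>G\<lparr>carrier := Z\<rparr> Mod B\<^esub> A2) =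
        (B' <#>\<^bsub>G'\<^esub> h ` A1) \<otimes>\<^bsub>G'\<lparr>carrier := Z'\<rparr> Mod B'\<^esub> (B' <#>\<^bsub>G'\<^esub> h ` A2)"
      using * [OF z(1)] * [OF w(1)] unfolding z w by (simp add: FactGroup_def set_mult_def)
  qed
qed

lemma subgroup_cycles: "subgroup (cycles K n) (chain_group K n)"
proof -
  interpret C: comm_group "chain_group K n" by (rule comm_group_chain_group)
  show ?thesis
  proof (rule C.subgroupI)
    have "(\<lambda>xs. 0) \<in> carrier (chain_group K n)"
      using C.one_closed by simp
    then have "(\<lambda>xs. 0) \<in> cycles K n"
      by (simp add: cycles_def boundary_def fun_eq_iff)
    then show "cycles K n \<noteq> {}"
      by blast
  next
    fix c assume c: "c \<in> cycles K n"
    let ?d = "inv\<^bsub>chain_group K n\<^esub> c"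
    have cd: "c \<in> carrier (chain_group K n)" "?d \<in> carrier (chain_group K n)"
      using c C.inv_closed by (auto simp: cycles_def)
    have "(\<lambda>xs. ?d xs + c xs) = (\<lambda>xs. 0)"
      using C.l_inv [OF cd(1)] by simp
    then have "boundary (\<lambda>xs. ?d xs + c xs) = (\<lambda>ys. 0)"
      by (simp add: boundary_def fun_eq_iff)
    then have "(\<lambda>ys. boundary ?d ys + boundary c ys) = (\<lambda>ys. 0)"
      using boundary_add [OF cd(2,1)] by simp
    then have "boundary ?d = (\<lambda>ys. 0)"
      using c by (simp add: cycles_def)
    then show "?d \<in> cycles K n"
      using cd by (simp add: cycles_def)
  next
    fix c c' assume "c \<in> cycles K n" "c' \<in> cycles K n"
    then show "c \<otimes>\<^bsub>chain_group K n\<^esub> c' \<in> cycles K n"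
      by (auto simp: cycles_def boundary_add chain_add_closed)
  qed (auto simp: cycles_def)
qed

lemma subgroup_boundaries:
  assumes "simplicial_complex K"
  shows "subgroup (boundaries K n) (chain_group K n)" "boundaries K n \<subseteq> cycles K n"
proof -
  interpret group_hom "chain_group K (Suc n)" "chain_group K n" boundary
    using boundary_hom [OF assms]
    by (auto simp: group_hom_def group_hom_axioms_def
        intro: comm_group.axioms(2) comm_group_chain_group)
  show "subgroup (boundaries K n) (chain_group K n)"
    unfolding boundaries_def by (rule img_is_subgroup)
  show "boundaries K n \<subseteq> cycles K n"
    using boundary_closed [OF assms] boundary_boundary
    unfolding boundaries_def cycles_def by blast
qed

lemma comm_group_simplicial_homology:
  "simplicial_complex K \<Longrightarrow> comm_group (simplicial_homology K n)"
  unfolding simplicial_homology_def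
  by (intro comm_group_subquotient comm_group_chain_group subgroup_cycles subgroup_boundaries)

lemma chain_group_mono:
  assumes "K \<subseteq> L" and c: "c \<in> carrier (chain_group K n)"
  shows "c \<in> carrier (chain_group L n)"
proof (rule chainI)
  show "xs \<in> ordered_simplices L n" if "c xs \<noteq> 0" for xs
    using chainD(2) [OF c that] assms(1) by (auto simp: ordered_simplices_def)
qed (use chainD(1) [OF c] chain_alternating [OF c] in blast)+

lemma homology_inclusion:
  assumes K: "simplicial_complex K" and L: "simplicial_complex L" and "K \<subseteq> L"
  shows "homology_inclusion L n \<in> hom (simplicial_homology K n) (simplicial_homology L n)"
    and "z \<in> cycles K n \<Longrightarrow>
      homology_inclusion L n (boundaries K n #>\<^bsub>chain_group K n\<^esub> z) =
      boundaries L n #>\<^bsub>chain_group L n\<^esub> z"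
proof -
  have h: "(\<lambda>c. c) \<in> hom (chain_group K n) (chain_group L n)"
    using chain_group_mono [OF assms(3)] by (auto simp: hom_def)
  have Z: "(\<lambda>c. c) ` cycles K n \<subseteq> cycles L n" and B: "(\<lambda>c. c) ` boundaries K n \<subseteq> boundaries L n"
    using chain_group_mono [OF assms(3)] by (auto simp: cycles_def boundaries_def)
  note M = subquotient_map [OF
      comm_group_chain_group subgroup_cycles subgroup_boundaries [OF K]
      comm_group_chain_group subgroup_cycles subgroup_boundaries [OF L] h Z B]
  show "homology_inclusion L n \<in> hom (simplicial_homology K n) (simplicial_homology L n)"
    using M(1) by (simp add: homology_inclusion_def [abs_def] simplicial_homology_def)
  show "z \<in> cycles K n \<Longrightarrow>
      homology_inclusion L n (boundaries K n #>\<^bsub>chain_group K n\<^esub> z) =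
      boundaries L n #>\<^bsub>chain_group L n\<^esub> z"
    using M(2) by (simp add: homology_inclusion_def)
qed

lemma cochain_group_simps [simp]:
  "monoid.mult (cochain_group K n) = (\<lambda>\<phi> \<psi>. \<lambda>c\<in>carrier (chain_group K n). \<phi> c + \<psi> c)"
  "one (cochain_group K n) = (\<lambda>c\<in>carrier (chain_group K n). 0)"
  by (simp_all add: cochain_group_def)

lemma cochain_iff:
  "\<phi> \<in> carrier (cochain_group K n) \<longleftrightarrow>
     \<phi> \<in> extensional (carrier (chain_group K n)) \<and>
     (\<forall>c\<in>carrier (chain_group K n). \<forall>c'\<in>carrier (chain_group K n).
        \<phi> (\<lambda>xs. c xs + c' xs) = \<phi> c + \<phi> c')"
  by (auto simp: cochain_group_def hom_def integer_group_def)

lemma comm_group_cochain_group: "comm_group (cochain_group K n)"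
proof (rule comm_groupI)
  fix \<phi> assume \<phi>: "\<phi> \<in> carrier (cochain_group K n)"
  have "(\<lambda>c\<in>carrier (chain_group K n). - \<phi> c) \<in> carrier (cochain_group K n)"
    using \<phi> by (auto simp: cochain_iff chain_add_closed)
  then show "\<exists>\<psi>\<in>carrier (cochain_group K n). \<psi> \<otimes>\<^bsub>cochain_group K n\<^esub> \<phi> = \<one>\<^bsub>cochain_group K n\<^esub>"
    by (rule bexI [rotated]) (auto simp: fun_eq_iff restrict_def)
next
  fix \<phi> assume "\<phi> \<in> carrier (cochain_group K n)"
  then show "\<one>\<^bsub>cochain_group K n\<^esub> \<otimes>\<^bsub>cochain_group K n\<^esub> \<phi> = \<phi>"
    by (auto simp: cochain_iff fun_eq_iff restrict_def extensional_def)
qed (auto simp: cochain_iff chain_add_closed algebra_simps fun_eq_iff restrict_def extensional_def)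

lemma coboundary_hom:
  assumes "simplicial_complex K"
  shows "coboundary K n \<in> hom (cochain_group K n) (cochain_group K (Suc n))"
  by (rule homI)
    (auto simp: cochain_iff coboundary_def chain_add_closed boundary_add boundary_closed [OF assms]
      fun_eq_iff restrict_def extensional_def)

lemma cochain_zero: "\<phi> \<in> carrier (cochain_group K n) \<Longrightarrow> \<phi> (\<lambda>xs. 0) = 0"
proof -
  assume \<phi>: "\<phi> \<in> carrier (cochain_group K n)"
  have "(\<lambda>xs. 0) \<in> carrier (chain_group K n)"
    by (rule chainI) auto
  then have "\<phi> (\<lambda>xs. 0 + 0) = \<phi> (\<lambda>xs. 0) + \<phi> (\<lambda>xs. 0)"
    using \<phi> unfolding cochain_iff by (elim conjE ballE) auto
  then show ?thesis by simp
qed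

lemma coboundary_coboundary:
  assumes K: "simplicial_complex K" and "\<phi> \<in> carrier (cochain_group K n)"
  shows "coboundary K (Suc n) (coboundary K n \<phi>) = \<one>\<^bsub>cochain_group K (Suc (Suc n))\<^esub>"
proof -
  have "coboundary K n \<phi> (boundary c) = 0" if c: "c \<in> carrier (chain_group K (Suc (Suc n)))" for c
    using boundary_closed [OF K c] cochain_zero [OF assms(2)]
    by (simp add: coboundary_def boundary_boundary [OF c])
  then show ?thesis
    unfolding coboundary_def [of K "Suc n"] cochain_group_simps by (intro restrict_ext)
qed

lemma subgroup_cocycles:
  assumes "simplicial_complex K"
  shows "subgroup (cocycles K n) (cochain_group K n)"
proof -
  interpret group_hom "cochain_group K n" "cochain_group K (Suc n)" "coboundary K n"
    using coboundary_hom [OF assms]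
    by (auto simp: group_hom_def group_hom_axioms_def
        intro: comm_group.axioms(2) comm_group_cochain_group)
  show ?thesis
    using subgroup_kernel by (simp only: kernel_def cocycles_def)
qed

lemma subgroup_coboundaries:
  assumes K: "simplicial_complex K"
  shows "subgroup (coboundaries K n) (cochain_group K n)" "coboundaries K n \<subseteq> cocycles K n"
proof -
  interpret C: comm_group "cochain_group K n" by (rule comm_group_cochain_group)
  have "subgroup (coboundaries K n) (cochain_group K n) \<and> coboundaries K n \<subseteq> cocycles K n"
  proof (cases n)
    case 0
    then show ?thesis
      using C.triv_subgroup subgroup.one_closed [OF subgroup_cocycles [OF K], of n]
      by (auto simp: coboundaries_def)
  next
    case (Suc m)
    interpret group_hom "cochain_group K m" "cochain_group K n" "coboundary K m"
      using coboundary_hom [OF K] unfolding Suc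
      by (auto simp: group_hom_def group_hom_axioms_def
          intro: comm_group.axioms(2) comm_group_cochain_group)
    have "coboundary K m \<phi> \<in> cocycles K n" if "\<phi> \<in> carrier (cochain_group K m)" for \<phi>
      using coboundary_coboundary [OF K that] hom_closed [OF that]
      unfolding cocycles_def Suc by blast
    then show ?thesis
      using img_is_subgroup by (auto simp: coboundaries_def Suc)
  qed
  then show "subgroup (coboundaries K n) (cochain_group K n)" "coboundaries K n \<subseteq> cocycles K n"
    by auto
qed

lemma comm_group_simplicial_cohomology:
  "simplicial_complex K \<Longrightarrow> comm_group (simplicial_cohomology K n)"
  unfolding simplicial_cohomology_def
  by (intro comm_group_subquotient comm_group_cochain_group subgroup_cocycles subgroup_coboundaries)

lemma cohomology_inclusion:
  assumes K: "simplicial_complex K" and L: "simplicial_complex L" and KL: "K \<subseteq> L"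
  shows "cohomology_inclusion K n \<in> hom (simplicial_cohomology L n) (simplicial_cohomology K n)"
    and "\<phi> \<in> cocycles L n \<Longrightarrow>
      cohomology_inclusion K n (coboundaries L n #>\<^bsub>cochain_group L n\<^esub> \<phi>) =
      coboundaries K n #>\<^bsub>cochain_group K n\<^esub> restrict \<phi> (carrier (chain_group K n))"
proof -
  let ?r = "\<lambda>n \<phi>. restrict \<phi> (carrier (chain_group K n))"
  have h: "?r n \<in> hom (cochain_group L n) (cochain_group K n)" for n
    by (rule homI)
      (auto simp: cochain_iff chain_group_mono [OF KL] chain_add_closed fun_eq_iff restrict_def extensional_def)
  have cb: "coboundary K n (?r n \<phi>) = ?r (Suc n) (coboundary L n \<phi>)" for n \<phi>
    by (auto simp: coboundary_def fun_eq_iff restrict_def boundary_closed [OF K]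
        chain_group_mono [OF KL])
  have Z: "?r n ` cocycles L n \<subseteq> cocycles K n"
  proof
    fix \<psi> assume "\<psi> \<in> ?r n ` cocycles L n"
    then obtain \<phi> where \<phi>: "\<phi> \<in> cocycles L n" "\<psi> = ?r n \<phi>" by blast
    have "\<psi> \<in> carrier (cochain_group K n)"
      using \<phi> hom_in_carrier [OF h] by (auto simp: cocycles_def)
    moreover have "coboundary K n \<psi> = \<one>\<^bsub>cochain_group K (Suc n)\<^esub>"
    proof -
      have "coboundary L n \<phi> = (\<lambda>c\<in>carrier (chain_group L (Suc n)). 0)"
        using \<phi> by (simp add: cocycles_def)
      then show ?thesis
        unfolding \<phi>(2) cb by (auto simp: restrict_def chain_group_mono [OF KL])
    qed
    ultimately show "\<psi> \<in> cocycles K n"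
      by (simp add: cocycles_def)
  qed
  have B: "?r n ` coboundaries L n \<subseteq> coboundaries K n"
  proof (cases n)
    case 0
    then show ?thesis
      by (auto simp: coboundaries_def fun_eq_iff restrict_def chain_group_mono [OF KL])
  next
    case (Suc m)
    then show ?thesis
      using hom_in_carrier [OF h [of m]] by (auto simp: coboundaries_def cb [symmetric])
  qed
  note M = subquotient_map [OF
      comm_group_cochain_group subgroup_cocycles [OF L] subgroup_coboundaries [OF L]
      comm_group_cochain_group subgroup_cocycles [OF K] subgroup_coboundaries [OF K] h Z B]
  show "cohomology_inclusion K n \<in> hom (simplicial_cohomology L n) (simplicial_cohomology K n)"
    using M(1) by (simp add: cohomology_inclusion_def [abs_def] simplicial_cohomology_def)
  show "\<phi> \<in> cocycles L n \<Longrightarrow>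
      cohomology_inclusion K n (coboundaries L n #>\<^bsub>cochain_group L n\<^esub> \<phi>) =
      coboundaries K n #>\<^bsub>cochain_group K n\<^esub> restrict \<phi> (carrier (chain_group K n))"
    using M(2) by (simp add: cohomology_inclusion_def)
qed

lemma simplicial_complex_vr_complex: "simplicial_complex (vr_complex X U)"
proof -
  have "t \<in> vr_complex X U" if s: "s \<in> vr_complex X U" and t: "t \<subseteq> s" "t \<noteq> {}" for s t
  proof -
    obtain xs where xs: "s = set xs" "distinct xs" "set xs \<subseteq> X" "sorted_wrt (\<lambda>x y. (x, y) \<in> U) xs"
      using s by (auto simp: vr_complex_def)
    let ?ys = "filter (\<lambda>x. x \<in> t) xs"
    have "set ?ys = t"
      using xs t by auto
    moreover have "?ys \<noteq> []"
      using \<open>set ?ys = t\<close> t by force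
    moreover have "distinct ?ys" "set ?ys \<subseteq> X" "sorted_wrt (\<lambda>x y. (x, y) \<in> U) ?ys"
      using xs by (auto simp: sorted_wrt_filter)
    ultimately show ?thesis
      unfolding vr_complex_def by blast
  qed
  then show ?thesis
    unfolding simplicial_complex_def by (auto simp: vr_complex_def)
qed

lemma entourages_semi_uniformity_at:
  "U \<in> entourages X (semi_uniformity_at X d q) \<longleftrightarrow>
     U \<subseteq> X \<times> X \<and> (\<exists>r>0. {(x, y). x \<in> X \<and> y \<in> X \<and> scaled_dist d q x y < r} \<subseteq> U)"
proof -
  have "eventually P (semi_uniformity_at X d q) \<longleftrightarrow>
      (\<exists>r\<in>{0<..}. eventually P (principal {(x, y). x \<in> X \<and> y \<in> X \<and> scaled_dist d q x y < r}))"
    for P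
    unfolding semi_uniformity_at_def
  proof (rule eventually_INF_base)
    fix a b :: real assume "a \<in> {0<..}" "b \<in> {0<..}"
    then show "\<exists>x\<in>{0<..}. principal {(x', y). x' \<in> X \<and> y \<in> X \<and> scaled_dist d q x' y < x} \<le>
        inf (principal {(x, y). x \<in> X \<and> y \<in> X \<and> scaled_dist d q x y < a})
            (principal {(x, y). x \<in> X \<and> y \<in> X \<and> scaled_dist d q x y < b})"
      by (intro bexI [of _ "min a b"]) auto
  qed (auto intro: exI [of _ 1])
  then show ?thesis
    unfolding entourages_def by (auto simp: eventually_principal subset_iff)
qed

lemma semi_uniform_structure_semi_uniformity_at:
  assumes d: "semi_pseudometric X d" and q: "q \<ge> 0"
  shows "semi_uniform_structure X (semi_uniformity_at X d q)"
proof -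
  have "semi_uniformity_at X d q \<le>
      principal {(x, y). x \<in> X \<and> y \<in> X \<and> scaled_dist d q x y < 1}"
    unfolding semi_uniformity_at_def by (rule INF_lower) simp
  also have "\<dots> \<le> principal (X \<times> X)"
    by auto
  finally have le: "semi_uniformity_at X d q \<le> principal (X \<times> X)" .
  have sym: "scaled_dist d q x y = scaled_dist d q y x" if "x \<in> X" "y \<in> X" for x y
    using d that by (auto simp: semi_pseudometric_def scaled_dist_def)
  have refl: "scaled_dist d q x x = 0" if "x \<in> X" for x
    using d q that by (auto simp: semi_pseudometric_def scaled_dist_def)
  show ?thesis
    unfolding semi_uniform_structure_def
  proof (intro conjI ballI le)
    fix U assume "U \<in> entourages X (semi_uniformity_at X d q)"
    then obtain r where r: "r > 0" "U \<subseteq> X \<times> X"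
        "{(x, y). x \<in> X \<and> y \<in> X \<and> scaled_dist d q x y < r} \<subseteq> U"
      by (auto simp: entourages_semi_uniformity_at)
    show "Id_on X \<subseteq> U"
      using r refl by auto
    show "U\<inverse> \<in> entourages X (semi_uniformity_at X d q)"
      unfolding entourages_semi_uniformity_at using r sym by (auto intro!: exI [of _ r])
  qed
qed

end

theory Submission
  imports Defs "HOL-Algebra.FiniteProduct"
begin

text \<open>Since X is finite, the values of d exceeding q stay away from q, so \<open>U\<^sub>\<le>\<^sub>q\<close> is itself an
  entourage, and it is contained in all others. The inverse system in homology thus has an
  initial index and the direct system in cohomology a terminal one, and the limit and the
  colimit are the groups at that index.\<close>

section \<open>Limits over a system with an initial index\<close>

text \<open>Projection to the coordinate m is the isomorphism. Compatibility along
  \<open>R m i\<close> forces \<open>x i = f m i (x m)\<close>, so a family is determined by its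
  value at m; conversely the images of any a in \<open>G m\<close> form a family that is compatible
  by \<open>comp\<close>.\<close>

lemma limit_group_initial_iso:
  assumes m: "m \<in> I" and Rm: "\<And>i. i \<in> I \<Longrightarrow> R m i"
    and closed: "\<And>i a. i \<in> I \<Longrightarrow> a \<in> carrier (G m) \<Longrightarrow> f m i a \<in> carrier (G i)"
    and id: "\<And>a. a \<in> carrier (G m) \<Longrightarrow> f m m a = a"
    and comp: "\<And>i j a. i \<in> I \<Longrightarrow> j \<in> I \<Longrightarrow> R i j \<Longrightarrow> a \<in> carrier (G m) \<Longrightarrow>
      f i j (f m i a) = f m j a"
  shows "limit_group I R G f \<cong> G m"
proof -
  have "(\<lambda>x. x m) \<in> hom (limit_group I R G f) (G m)"
    using m by (auto simp: limit_group_def hom_def)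
  moreover have "bij_betw (\<lambda>x. x m) (carrier (limit_group I R G f)) (carrier (G m))"
  proof (rule bij_betw_byWitness [where f' = "\<lambda>a. \<lambda>i\<in>I. f m i a"])
    show "\<forall>x\<in>carrier (limit_group I R G f). (\<lambda>i\<in>I. f m i (x m)) = x"
    proof
      fix x assume x: "x \<in> carrier (limit_group I R G f)"
      then have "f m i (x m) = x i" if "i \<in> I" for i
        using m Rm that by (simp add: limit_group_def)
      \<comment> \<open>Off I both families take the value \<open>undefined\<close>, so agreement on
        I is enough.\<close>
      moreover have "x \<in> extensional I"
        using x by (simp add: limit_group_def PiE_def)
      ultimately show "(\<lambda>i\<in>I. f m i (x m)) = x"
        by (auto simp: extensional_def)
    qed
    show "(\<lambda>a. \<lambda>i\<in>I. f m i a) ` carrier (G m) \<subseteq> carrier (limit_group I R G f)"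
      using closed comp by (auto simp: limit_group_def)
  qed (use m id in \<open>auto simp: limit_group_def\<close>)
  ultimately show ?thesis
    unfolding is_iso_def iso_def by blast
qed

section \<open>Direct sums and the homomorphisms out of them\<close>

lemma summand_inclusion_hom:
  assumes "\<And>i. i \<in> I \<Longrightarrow> group (G i)" and "i \<in> I"
  shows "summand_inclusion I G i \<in> hom (G i) (sum_group I G)"
proof (rule homI)
  note group.is_monoid [OF assms(1), simp]
  show "summand_inclusion I G i a \<in> carrier (sum_group I G)" if "a \<in> carrier (G i)" for a
  proof -
    have "finite {k \<in> I. summand_inclusion I G i a k \<noteq> \<one>\<^bsub>G k\<^esub>}"
      by (rule finite_subset [of _ "{i}"]) (auto simp: summand_inclusion_def)
    moreover have "summand_inclusion I G i a \<in> (\<Pi>\<^sub>E k\<in>I. carrier (G k))"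
      using that by (auto simp: summand_inclusion_def)
    ultimately show ?thesis
      by (simp add: carrier_sum_group assms(1))
  qed
  show "summand_inclusion I G i (a \<otimes>\<^bsub>G i\<^esub> b) =
      summand_inclusion I G i a \<otimes>\<^bsub>sum_group I G\<^esub> summand_inclusion I G i b" for a b
    by (auto simp: summand_inclusion_def fun_eq_iff)
qed

lemma summand_inclusion_closed:
  assumes "\<And>i. i \<in> I \<Longrightarrow> group (G i)" and "i \<in> I" and "a \<in> carrier (G i)"
  shows "summand_inclusion I G i a \<in> carrier (sum_group I G)"
  by (rule hom_in_carrier [OF summand_inclusion_hom]) (use assms in auto)

text \<open>An element of the direct sum has finite support, so it is a finite product of elements
  of single summands; these are split off one coordinate at a time.\<close>

lemma sum_group_induct [consumes 1, case_names group inclusion one mult]: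
  assumes x: "x \<in> carrier (sum_group I G)" and G: "\<And>i. i \<in> I \<Longrightarrow> group (G i)"
    and incl: "\<And>i a. i \<in> I \<Longrightarrow> a \<in> carrier (G i) \<Longrightarrow> P (summand_inclusion I G i a)"
    and one: "P \<one>\<^bsub>sum_group I G\<^esub>"
    and mult: "\<And>x y. x \<in> carrier (sum_group I G) \<Longrightarrow> y \<in> carrier (sum_group I G) \<Longrightarrow>
      P x \<Longrightarrow> P y \<Longrightarrow> P (x \<otimes>\<^bsub>sum_group I G\<^esub> y)"
  shows "P x"
proof -
  note group.is_monoid [OF G, simp]
  \<comment> \<open>The induction runs over a finite set S that contains the support, with x
    arbitrary, because x changes whenever a coordinate is removed.\<close>
  have *: "P x" if "finite S" "S \<subseteq> I" "x \<in> carrier (sum_group I G)" "\<And>i. i \<in> I - S \<Longrightarrow> x i = \<one>\<^bsub>G i\<^esub>"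
    for S x
    using that
  proof (induction S arbitrary: x rule: finite_induct)
    case empty
    then have "x = \<one>\<^bsub>sum_group I G\<^esub>"
      by (auto simp: carrier_sum_group G PiE_def extensional_def fun_eq_iff)
    then show ?case using one by (simp only:)
  next
    case (insert i S)
    \<comment> \<open>Resetting the coordinate i leaves an element supported in S, and multiplying
      by the inclusion of \<open>x i\<close> restores x.\<close>
    define y where "y = (\<lambda>k\<in>I. if k = i then \<one>\<^bsub>G k\<^esub> else x k)"
    have i: "i \<in> I" and xi: "x i \<in> carrier (G i)"
      using insert.prems by (auto simp: carrier_sum_group G)
    have "finite {k \<in> I. y k \<noteq> \<one>\<^bsub>G k\<^esub>}"
      by (rule finite_subset [OF _ insert.hyps(1)]) (use insert.prems in \<open>auto simp: y_def\<close>)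
    moreover have "y \<in> (\<Pi>\<^sub>E k\<in>I. carrier (G k))"
      using insert.prems(2) by (auto simp: y_def carrier_sum_group G)
    ultimately have y: "y \<in> carrier (sum_group I G)"
      by (simp add: carrier_sum_group G)
    have "P y"
      by (rule insert.IH [OF _ y]) (use insert.prems in \<open>auto simp: y_def\<close>)
    then have "P (y \<otimes>\<^bsub>sum_group I G\<^esub> summand_inclusion I G i (x i))"
      using y i xi by (intro mult incl summand_inclusion_closed G)
    also have "y \<otimes>\<^bsub>sum_group I G\<^esub> summand_inclusion I G i (x i) = x"
    proof
      fix k
      have "k \<in> I \<Longrightarrow> x k \<in> carrier (G k)" "k \<notin> I \<Longrightarrow> x k = undefined"
        using insert.prems(2) by (auto simp: carrier_sum_group G)
      with xi show "(y \<otimes>\<^bsub>sum_group I G\<^esub> summand_inclusion I G i (x i)) k = x k"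
        by (simp add: y_def summand_inclusion_def)
    qed
    finally show ?case .
  qed
  have "finite {i \<in> I. x i \<noteq> \<one>\<^bsub>G i\<^esub>}"
    using x by (simp add: carrier_sum_group G)
  then show ?thesis
    by (rule *) (use x in auto)
qed

lemma comm_group_sum_group:
  assumes G: "\<And>i. i \<in> I \<Longrightarrow> comm_group (G i)"
  shows "comm_group (sum_group I G)"
proof (rule group.group_comm_groupI)
  note G' = comm_group.axioms(2) [OF G]
  show "group (sum_group I G)"
    by (simp add: G')
  show "x \<otimes>\<^bsub>sum_group I G\<^esub> y = y \<otimes>\<^bsub>sum_group I G\<^esub> x"
    if "x \<in> carrier (sum_group I G)" "y \<in> carrier (sum_group I G)" for x y
    using that by (auto simp: carrier_sum_group G' intro!: restrict_ext comm_monoid.m_comm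
        comm_group.axioms(1) G)
qed

text \<open>The map given by the universal property of the direct sum. Restricting the product to
  the support makes it finite even when I is infinite.\<close>

definition sum_group_fold ::
    "'i set \<Rightarrow> ('i \<Rightarrow> 'g monoid) \<Rightarrow> ('i \<Rightarrow> 'g \<Rightarrow> 'h) \<Rightarrow> 'h monoid \<Rightarrow> ('i \<Rightarrow> 'g) \<Rightarrow> 'h" where
  "sum_group_fold I G h H x = finprod H (\<lambda>i. h i (x i)) {i \<in> I. x i \<noteq> \<one>\<^bsub>G i\<^esub>}"

lemma
  assumes G: "\<And>i. i \<in> I \<Longrightarrow> group (G i)" and H: "comm_group H"
    and h: "\<And>i. i \<in> I \<Longrightarrow> h i \<in> hom (G i) H"
  shows sum_group_fold_hom: "sum_group_fold I G h H \<in> hom (sum_group I G) H"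
    and sum_group_fold_inclusion:
      "\<And>i a. i \<in> I \<Longrightarrow> a \<in> carrier (G i) \<Longrightarrow> sum_group_fold I G h H (summand_inclusion I G i a) = h i a"
proof -
  interpret H: comm_group H by (rule H)
  have h1: "h i \<one>\<^bsub>G i\<^esub> = \<one>\<^bsub>H\<^esub>" if "i \<in> I" for i
    using hom_one [OF h G H.group_axioms] that by blast
  have hc: "h i a \<in> carrier H" if "i \<in> I" "a \<in> carrier (G i)" for i a
    using hom_in_carrier [OF h] that by blast
  \<comment> \<open>Each \<open>h i\<close> preserves the identity, so any finite set containing the
    support gives the same product. This allows elements with different supports to be
    compared.\<close>
  have sup: "sum_group_fold I G h H x = finprod H (\<lambda>i. h i (x i)) S"
    if "x \<in> carrier (sum_group I G)" "finite S" "S \<subseteq> I" "{i \<in> I. x i \<noteq> \<one>\<^bsub>G i\<^esub>} \<subseteq> S" for x S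
    unfolding sum_group_fold_def
    by (rule H.finprod_mono_neutral_cong_left)
      (use that h1 hc in \<open>auto simp: carrier_sum_group G PiE_iff subset_iff Pi_iff\<close>)
  show "sum_group_fold I G h H \<in> hom (sum_group I G) H"
  proof (rule homI)
    fix x assume x: "x \<in> carrier (sum_group I G)"
    show "sum_group_fold I G h H x \<in> carrier H"
      unfolding sum_group_fold_def
      by (rule H.finprod_closed) (use x hc in \<open>auto simp: carrier_sum_group G PiE_iff\<close>)
    fix y assume y: "y \<in> carrier (sum_group I G)"
    \<comment> \<open>A common index set for x, y and their product: off this union the product is
      trivial as well.\<close>
    let ?S = "{i \<in> I. x i \<noteq> \<one>\<^bsub>G i\<^esub>} \<union> {i \<in> I. y i \<noteq> \<one>\<^bsub>G i\<^esub>}"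
    have S: "finite ?S" "?S \<subseteq> I"
      using x y by (auto simp: carrier_sum_group G)
    have xy: "x i \<in> carrier (G i)" "y i \<in> carrier (G i)" if "i \<in> I" for i
      using x y that by (auto simp: carrier_sum_group G)
    have "x \<otimes>\<^bsub>sum_group I G\<^esub> y \<in> carrier (sum_group I G)"
      using x y by (intro monoid.m_closed group.is_monoid) (auto simp: G)
    then have "sum_group_fold I G h H (x \<otimes>\<^bsub>sum_group I G\<^esub> y) =
        finprod H (\<lambda>i. h i ((x \<otimes>\<^bsub>sum_group I G\<^esub> y) i)) ?S"
      by (rule sup [OF _ S]) (use G in \<open>auto simp: group.is_monoid\<close>)
    also have "\<dots> = finprod H (\<lambda>i. h i (x i) \<otimes>\<^bsub>H\<^esub> h i (y i)) ?S"
      by (rule H.finprod_cong') (use xy hc h in \<open>auto simp: hom_mult\<close>)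
    also have "\<dots> = finprod H (\<lambda>i. h i (x i)) ?S \<otimes>\<^bsub>H\<^esub> finprod H (\<lambda>i. h i (y i)) ?S"
      by (rule H.finprod_multf) (use xy hc in auto)
    also have "\<dots> = sum_group_fold I G h H x \<otimes>\<^bsub>H\<^esub> sum_group_fold I G h H y"
      using sup [OF x S] sup [OF y S] by auto
    finally show "sum_group_fold I G h H (x \<otimes>\<^bsub>sum_group I G\<^esub> y) =
        sum_group_fold I G h H x \<otimes>\<^bsub>H\<^esub> sum_group_fold I G h H y" .
  qed
  fix i a assume i: "i \<in> I" and a: "a \<in> carrier (G i)"
  \<comment> \<open>The support is \<open>{i}\<close>, or empty if a is the identity;
    \<open>sup\<close> covers both cases.\<close>
  have "sum_group_fold I G h H (summand_inclusion I G i a) =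
      finprod H (\<lambda>k. h k (summand_inclusion I G i a k)) {i}"
    by (rule sup [OF summand_inclusion_closed [of I G, OF G i a]])
      (use i in \<open>auto simp: summand_inclusion_def split: if_splits\<close>)
  also have "\<dots> = h i a"
    using i a hc by (simp add: summand_inclusion_def)
  finally show "sum_group_fold I G h H (summand_inclusion I G i a) = h i a" .
qed

section \<open>Colimits over a system with a terminal index\<close>

text \<open>The maps \<open>f i m\<close> induce a homomorphism \<open>\<phi>\<close> from the
  direct sum onto \<open>G m\<close>. Its kernel is exactly the subgroup generated by the relators
  of the colimit, so the first isomorphism theorem applies.\<close>

lemma colimit_group_terminal_iso:
  fixes G :: "'i \<Rightarrow> 'g monoid"
  assumes m: "m \<in> I" and Rm: "\<And>i. i \<in> I \<Longrightarrow> R i m"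
    and G: "\<And>i. i \<in> I \<Longrightarrow> comm_group (G i)"
    and hom: "\<And>i j. i \<in> I \<Longrightarrow> j \<in> I \<Longrightarrow> R i j \<Longrightarrow> f i j \<in> hom (G i) (G j)"
    and id: "\<And>a. a \<in> carrier (G m) \<Longrightarrow> f m m a = a"
    and comp: "\<And>i j a. i \<in> I \<Longrightarrow> j \<in> I \<Longrightarrow> R i j \<Longrightarrow> a \<in> carrier (G i) \<Longrightarrow>
      f j m (f i j a) = f i m a"
  shows "colimit_group I R G f \<cong> G m"
proof -
  let ?S = "sum_group I G" and ?\<iota> = "summand_inclusion I G"
  note G' = comm_group.axioms(2) [OF G]
  interpret S: comm_group ?S
    by (rule comm_group_sum_group [OF G])
  interpret Gm: comm_group "G m"
    by (rule G [OF m])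
  define \<phi> where "\<phi> = sum_group_fold I G (\<lambda>i. f i m) (G m)"
  have \<phi>_hom: "\<phi> \<in> hom ?S (G m)"
    unfolding \<phi>_def by (rule sum_group_fold_hom) (use G' G hom m Rm in auto)
  have \<phi>_incl: "\<phi> (?\<iota> i a) = f i m a" if "i \<in> I" "a \<in> carrier (G i)" for i a
    unfolding \<phi>_def by (rule sum_group_fold_inclusion) (use G' G hom m Rm that in auto)
  interpret \<phi>: group_hom ?S "G m" \<phi>
    using \<phi>_hom by (simp add: group_hom_def group_hom_axioms_def)
  have incl [simp]: "?\<iota> i a \<in> carrier ?S" if "i \<in> I" "a \<in> carrier (G i)" for i a
    using that by (intro summand_inclusion_closed G')
  have "?\<iota> m \<in> hom (G m) ?S"
    using G' m by (rule summand_inclusion_hom)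
  then interpret \<iota>: group_hom "G m" ?S "?\<iota> m"
    by (simp add: group_hom_def group_hom_axioms_def)
  \<comment> \<open>The generating set from \<open>colimit_group_def\<close>, so that the quotient
    by \<open>?N\<close> below is literally the colimit.\<close>
  define T where "T = {?\<iota> i a \<otimes>\<^bsub>?S\<^esub> inv\<^bsub>?S\<^esub> (?\<iota> j (f i j a)) | i j a.
      i \<in> I \<and> j \<in> I \<and> R i j \<and> a \<in> carrier (G i)}"
  have fc: "f i j a \<in> carrier (G j)" if "i \<in> I" "j \<in> I" "R i j" "a \<in> carrier (G i)" for i j a
    using hom_in_carrier [OF hom] that by blast
  have T: "T \<subseteq> carrier ?S"
    \<comment> \<open>Here and below the deleted simp rules would unfold the operations of the
      direct sum into coordinates and hide the group laws.\<close>
    using fc by (auto simp: T_def intro!: S.m_closed S.inv_closed simp del: mult_sum_group inv_sum_group)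
  let ?N = "generate ?S T"
  have N: "subgroup ?N ?S"
    by (rule S.generate_is_subgroup [OF T])
  have "kernel ?S (G m) \<phi> = ?N"
  proof
    \<comment> \<open>A relator dies under \<open>\<phi>\<close> because going to m directly or
      through j gives the same element, by \<open>comp\<close>.\<close>
    have "T \<subseteq> kernel ?S (G m) \<phi>"
    proof
      fix t assume "t \<in> T"
      then obtain i j a where t: "t = ?\<iota> i a \<otimes>\<^bsub>?S\<^esub> inv\<^bsub>?S\<^esub> (?\<iota> j (f i j a))"
        and ij: "i \<in> I" "j \<in> I" "R i j" "a \<in> carrier (G i)"
        unfolding T_def by blast
      have "\<phi> t = f i m a \<otimes>\<^bsub>G m\<^esub> inv\<^bsub>G m\<^esub> (f j m (f i j a))"
        unfolding t using ij fc
        by (simp add: \<phi>_incl \<phi>.hom_mult \<phi>.hom_inv del: mult_sum_group inv_sum_group)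
      also have "\<dots> = \<one>\<^bsub>G m\<^esub>"
        using ij fc m Rm by (simp add: comp Gm.r_inv)
      finally show "t \<in> kernel ?S (G m) \<phi>"
        using T \<open>t \<in> T\<close> by (auto simp: kernel_def)
    qed
    then show "?N \<subseteq> kernel ?S (G m) \<phi>"
      by (rule S.generate_subgroup_incl) (rule \<phi>.subgroup_kernel)
  next
    \<comment> \<open>Modulo the relators, x is congruent to the copy of \<open>\<phi> x\<close> in
      the summand at m. For an element of one summand this quotient is itself the relator with
      \<open>j = m\<close>; products follow because the direct sum is commutative.\<close>
    have key: "x \<otimes>\<^bsub>?S\<^esub> inv\<^bsub>?S\<^esub> (?\<iota> m (\<phi> x)) \<in> ?N" if "x \<in> carrier ?S" for x
      using that
    proof (induction x rule: sum_group_induct)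
      case (group i)
      then show ?case by (rule G')
    next
      case (inclusion i a)
      then have "?\<iota> i a \<otimes>\<^bsub>?S\<^esub> inv\<^bsub>?S\<^esub> (?\<iota> m (f i m a)) \<in> T"
        unfolding T_def using m Rm by blast
      then show ?case
        using inclusion by (simp add: \<phi>_incl generate.incl del: mult_sum_group inv_sum_group)
    next
      case one
      show ?case
        using subgroup.one_closed [OF N]
        by (simp del: mult_sum_group inv_sum_group one_sum_group)
    next
      case (mult x y)
      have c: "?\<iota> m (\<phi> x) \<in> carrier ?S" "?\<iota> m (\<phi> y) \<in> carrier ?S"
        using mult m by auto
      have "?\<iota> m (\<phi> (x \<otimes>\<^bsub>?S\<^esub> y)) = ?\<iota> m (\<phi> x) \<otimes>\<^bsub>?S\<^esub> ?\<iota> m (\<phi> y)"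
        using mult by (simp del: mult_sum_group)
      then have "x \<otimes>\<^bsub>?S\<^esub> y \<otimes>\<^bsub>?S\<^esub> inv\<^bsub>?S\<^esub> (?\<iota> m (\<phi> (x \<otimes>\<^bsub>?S\<^esub> y))) =
          (x \<otimes>\<^bsub>?S\<^esub> inv\<^bsub>?S\<^esub> (?\<iota> m (\<phi> x))) \<otimes>\<^bsub>?S\<^esub> (y \<otimes>\<^bsub>?S\<^esub> inv\<^bsub>?S\<^esub> (?\<iota> m (\<phi> y)))"
        using mult c by (simp add: S.inv_mult S.m_ac del: mult_sum_group inv_sum_group)
      with mult show ?case
        by (simp add: subgroup.m_closed [OF N] del: mult_sum_group inv_sum_group)
    qed
    show "kernel ?S (G m) \<phi> \<subseteq> ?N"
    proof
      \<comment> \<open>For x in the kernel, the factor that \<open>key\<close> divides out is the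
        identity, leaving x itself in \<open>?N\<close>.\<close>
      fix x assume x: "x \<in> kernel ?S (G m) \<phi>"
      then have "x \<otimes>\<^bsub>?S\<^esub> inv\<^bsub>?S\<^esub> (?\<iota> m \<one>\<^bsub>G m\<^esub>) \<in> ?N"
        using key [of x] by (simp add: kernel_def)
      then show "x \<in> ?N"
        using x by (simp add: kernel_def del: mult_sum_group inv_sum_group one_sum_group)
    qed
  qed
  moreover have "\<phi> ` carrier ?S = carrier (G m)"
  proof
    \<comment> \<open>A preimage of a is its own copy in the summand at m, since
      \<open>f m m\<close> fixes a.\<close>
    show "carrier (G m) \<subseteq> \<phi> ` carrier ?S"
      using incl [OF m] \<phi>_incl [OF m] id by (metis image_eqI subsetI)
  qed auto
  ultimately show ?thesis
    using \<phi>.FactGroup_iso unfolding colimit_group_def T_def by simp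
qed

section \<open>Functoriality of homology and cohomology under inclusions\<close>

text \<open>Cosets depend only on the multiplication, so those taken inside the group of cycles are
  cosets in the whole chain group. Every class thereby gets a cycle as representative.\<close>

lemma carrier_simplicial_homology:
  "carrier (simplicial_homology K n) = (\<lambda>z. boundaries K n #>\<^bsub>chain_group K n\<^esub> z) ` cycles K n"
  by (simp add: simplicial_homology_def carrier_FactGroup r_coset_def)

lemma carrier_simplicial_cohomology:
  "carrier (simplicial_cohomology K n) =
     (\<lambda>\<phi>. coboundaries K n #>\<^bsub>cochain_group K n\<^esub> \<phi>) ` cocycles K n"
  by (simp add: simplicial_cohomology_def carrier_FactGroup r_coset_def)

lemma cycles_mono: "K \<subseteq> L \<Longrightarrow> cycles K n \<subseteq> cycles L n"
  using chain_group_mono by (auto simp: cycles_def)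

lemma homology_inclusion_same:
  assumes "simplicial_complex K" "A \<in> carrier (simplicial_homology K n)"
  shows "homology_inclusion K n A = A"
proof -
  obtain z where "z \<in> cycles K n" "A = boundaries K n #>\<^bsub>chain_group K n\<^esub> z"
    using assms(2) by (auto simp: carrier_simplicial_homology)
  then show ?thesis
    using homology_inclusion(2) [OF assms(1,1) subset_refl] by simp
qed

text \<open>On representatives every map involved is the identity: a cycle z of K stays a cycle in L
  and M, and both sides are the class of z in M.\<close>

lemma homology_inclusion_comp:
  assumes "simplicial_complex K" "simplicial_complex L" "simplicial_complex M" "K \<subseteq> L" "L \<subseteq> M"
    and "A \<in> carrier (simplicial_homology K n)"
  shows "homology_inclusion M n (homology_inclusion L n A) = homology_inclusion M n A"
proof -
  obtain z where z: "z \<in> cycles K n" "A = boundaries K n #>\<^bsub>chain_group K n\<^esub> z"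
    using assms(6) by (auto simp: carrier_simplicial_homology)
  then have "z \<in> cycles L n"
    using cycles_mono [OF assms(4)] by blast
  with z assms show ?thesis
    by (simp add: homology_inclusion(2) [of K L] homology_inclusion(2) [of K M]
        homology_inclusion(2) [of L M])
qed

text \<open>A chain of K is also a chain of L with the same boundary, so the cocycle condition over
  L can be evaluated on it.\<close>

lemma cocycles_restrict:
  assumes L: "simplicial_complex L" and K: "simplicial_complex K" and KL: "K \<subseteq> L"
    and \<phi>: "\<phi> \<in> cocycles L n"
  shows "restrict \<phi> (carrier (chain_group K n)) \<in> cocycles K n"
proof -
  have "\<phi> (boundary c) = 0" if "c \<in> carrier (chain_group K (Suc n))" for c
  proof -
    have "c \<in> carrier (chain_group L (Suc n))"
      using that by (rule chain_group_mono [OF KL])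
    moreover have "coboundary L n \<phi> c = \<one>\<^bsub>cochain_group L (Suc n)\<^esub> c"
      using \<phi> by (simp add: cocycles_def)
    ultimately show ?thesis
      by (simp add: coboundary_def)
  qed
  moreover have "restrict \<phi> (carrier (chain_group K n)) \<in> carrier (cochain_group K n)"
    using \<phi> by (auto simp: cocycles_def cochain_iff chain_add_closed chain_group_mono [OF KL])
  ultimately show ?thesis
    by (auto simp: cocycles_def coboundary_def boundary_closed [OF K] intro!: restrict_ext)
qed

lemma cohomology_inclusion_same:
  assumes "simplicial_complex K" "A \<in> carrier (simplicial_cohomology K n)"
  shows "cohomology_inclusion K n A = A"
proof -
  obtain \<phi> where \<phi>: "\<phi> \<in> cocycles K n" "A = coboundaries K n #>\<^bsub>cochain_group K n\<^esub> \<phi>"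
    using assms(2) by (auto simp: carrier_simplicial_cohomology)
  \<comment> \<open>Cochains are extensional, so restricting to their own domain changes
    nothing.\<close>
  then have "restrict \<phi> (carrier (chain_group K n)) = \<phi>"
    by (simp add: cocycles_def cochain_iff extensional_restrict)
  then show ?thesis
    using cohomology_inclusion(2) [OF assms(1,1) subset_refl \<phi>(1)] \<phi>(2) by simp
qed

lemma cohomology_inclusion_comp:
  assumes "simplicial_complex K" "simplicial_complex L" "simplicial_complex M" "K \<subseteq> L" "L \<subseteq> M"
    and "A \<in> carrier (simplicial_cohomology M n)"
  shows "cohomology_inclusion K n (cohomology_inclusion L n A) = cohomology_inclusion K n A"
proof -
  let ?r = "\<lambda>K \<phi>. restrict \<phi> (carrier (chain_group K n))"
  obtain \<phi> where \<phi>: "\<phi> \<in> cocycles M n" "A = coboundaries M n #>\<^bsub>cochain_group M n\<^esub> \<phi>"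
    using assms(6) by (auto simp: carrier_simplicial_cohomology)
  have "?r L \<phi> \<in> cocycles L n"
    by (rule cocycles_restrict) (use assms \<phi> in auto)
  \<comment> \<open>The chains of K lie among those of L, so the intermediate restriction never
    yields \<open>undefined\<close> on them.\<close>
  moreover have "?r K (?r L \<phi>) = ?r K \<phi>"
    using chain_group_mono [OF assms(4)] by (auto intro!: restrict_ext)
  ultimately show ?thesis
    using \<phi> assms by (simp add: cohomology_inclusion(2) [of K L] cohomology_inclusion(2) [of K M]
        cohomology_inclusion(2) [of L M])
qed

section \<open>Vietoris-Rips groups in the presence of a least entourage\<close>

lemma vr_complex_mono: "U \<subseteq> V \<Longrightarrow> vr_complex X U \<subseteq> vr_complex X V"
proof
  fix s assume UV: "U \<subseteq> V" and "s \<in> vr_complex X U"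
  then obtain xs where xs: "s = set xs" "xs \<noteq> []" "distinct xs" "set xs \<subseteq> X"
      "sorted_wrt (\<lambda>x y. (x, y) \<in> U) xs"
    by (auto simp: vr_complex_def)
  have "sorted_wrt (\<lambda>x y. (x, y) \<in> V) xs"
    by (rule sorted_wrt_mono_rel [OF _ xs(5)]) (use UV in blast)
  with xs show "s \<in> vr_complex X V"
    unfolding vr_complex_def by blast
qed

lemma vr_homology_least_entourage:
  assumes U: "U \<in> entourages X F" and least: "\<And>V. V \<in> entourages X F \<Longrightarrow> U \<subseteq> V"
  shows "vr_homology X F n \<cong> simplicial_homology (vr_complex X U) n"
  unfolding vr_homology_def
proof (rule limit_group_initial_iso [OF U])
  show "homology_inclusion (vr_complex X V) n A \<in> carrier (simplicial_homology (vr_complex X V) n)"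
    if "V \<in> entourages X F" "A \<in> carrier (simplicial_homology (vr_complex X U) n)" for V A
    by (rule hom_in_carrier [OF homology_inclusion(1) that(2)])
      (intro simplicial_complex_vr_complex vr_complex_mono least that)+
  \<comment> \<open>The complex of U is where A lives but does not occur in the equation, hence its
    explicit instantiation.\<close>
  show "homology_inclusion (vr_complex X W) n (homology_inclusion (vr_complex X V) n A) =
      homology_inclusion (vr_complex X W) n A"
    if "V \<in> entourages X F" "V \<subseteq> W" "A \<in> carrier (simplicial_homology (vr_complex X U) n)"
    for V W A
    using that
    by (intro homology_inclusion_comp [of "vr_complex X U"] simplicial_complex_vr_complex
        vr_complex_mono least)
qed (simp_all add: least homology_inclusion_same simplicial_complex_vr_complex)

text \<open>Restriction goes from larger to smaller entourages, so the index order is reverse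
  inclusion and U is terminal.\<close>

lemma vr_cohomology_least_entourage:
  assumes U: "U \<in> entourages X F" and least: "\<And>V. V \<in> entourages X F \<Longrightarrow> U \<subseteq> V"
  shows "vr_cohomology X F n \<cong> simplicial_cohomology (vr_complex X U) n"
  unfolding vr_cohomology_def
proof (rule colimit_group_terminal_iso [OF U])
  show "cohomology_inclusion (vr_complex X W) n
      \<in> hom (simplicial_cohomology (vr_complex X V) n) (simplicial_cohomology (vr_complex X W) n)"
    if "W \<subseteq> V" for V W
    using that by (intro cohomology_inclusion(1) simplicial_complex_vr_complex vr_complex_mono)
  show "cohomology_inclusion (vr_complex X U) n (cohomology_inclusion (vr_complex X W) n A) =
      cohomology_inclusion (vr_complex X U) n A"
    if "W \<in> entourages X F" "W \<subseteq> V" "A \<in> carrier (simplicial_cohomology (vr_complex X V) n)"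
    for V W A
    using that
    by (intro cohomology_inclusion_comp [of _ _ "vr_complex X V"] simplicial_complex_vr_complex
        vr_complex_mono least)
qed (simp_all add: least cohomology_inclusion_same comm_group_simplicial_cohomology
    simplicial_complex_vr_complex)

section \<open>The least entourage of a finite space at scale q\<close>

lemma least_entourage_semi_uniformity_at:
  assumes "finite X"
  shows "{(x, y). x \<in> X \<and> y \<in> X \<and> d x y \<le> q} \<in> entourages X (semi_uniformity_at X d q)"
    and "V \<in> entourages X (semi_uniformity_at X d q) \<Longrightarrow>
      {(x, y). x \<in> X \<and> y \<in> X \<and> d x y \<le> q} \<subseteq> V"
proof -
  \<comment> \<open>The positive excesses over q. The extra element 1 keeps D nonempty when no
    distance exceeds q, so that \<open>Min D\<close> is always a positive radius.\<close>
  define D where "D = insert 1 ((\<lambda>(x, y). d x y - q) ` {(x, y) \<in> X \<times> X. d x y > q})"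
  have "finite {(x, y) \<in> X \<times> X. d x y > q}"
    by (rule finite_subset [of _ "X \<times> X"]) (use assms in auto)
  then have D: "finite D" "D \<noteq> {}"
    by (auto simp: D_def)
  then have "Min D \<in> D"
    by (rule Min_in)
  then have "Min D > 0"
    unfolding D_def by auto
  \<comment> \<open>A pair at distance above q has its excess as scaled distance, which is at least
    \<open>Min D\<close>.\<close>
  moreover have "d x y \<le> q" if "x \<in> X" "y \<in> X" "scaled_dist d q x y < Min D" for x y
  proof (rule ccontr)
    assume "\<not> d x y \<le> q"
    then have "d x y - q \<in> D"
      using that by (force simp: D_def)
    then have "Min D \<le> d x y - q"
      using D by simp
    then show False
      using that \<open>\<not> d x y \<le> q\<close> by (simp add: scaled_dist_def)
  qed
  ultimately show "{(x, y). x \<in> X \<and> y \<in> X \<and> d x y \<le> q} \<in> entourages X (semi_uniformity_at X d q)"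
    unfolding entourages_semi_uniformity_at by (auto intro!: exI [of _ "Min D"])
  \<comment> \<open>Pairs at distance at most q have scaled distance 0, which is below every radius
    r.\<close>
  show "{(x, y). x \<in> X \<and> y \<in> X \<and> d x y \<le> q} \<subseteq> V"
    if "V \<in> entourages X (semi_uniformity_at X d q)"
    using that by (fastforce simp: entourages_semi_uniformity_at scaled_dist_def)
qed

theorem theorem5p2:
  fixes X :: "'a set" and d :: "'a \<Rightarrow> 'a \<Rightarrow> real" and q :: real
  assumes "semi_pseudometric X d" and "finite X" and "q > 0"
  shows "(\<forall>n. vr_homology X (semi_uniformity_at X d q) n \<cong>
              simplicial_homology (vr_complex X {(x, y). x \<in> X \<and> y \<in> X \<and> d x y \<le> q}) n) \<and>
         (\<forall>n. vr_cohomology X (semi_uniformity_at X d q) n \<cong>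
              simplicial_cohomology (vr_complex X {(x, y). x \<in> X \<and> y \<in> X \<and> d x y \<le> q}) n)"
  by (intro conjI allI vr_homology_least_entourage vr_cohomology_least_entourage
      least_entourage_semi_uniformity_at [OF \<open>finite X\<close>])

end
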